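(* Let $0<q\le 1$, let $w$ be a coupling weight function on $\mathbb{Z}\times\mathbb{Z}$ that is admissible (for the exponent $q$, with quasi-distance $\rho(i,j)=|i-j|$), and suppose that $K=[K_{ij}]_{i,j\in\mathbb{Z}}\in\mathcal{S}_{q,w}(\mathbb{Z})$. For a truncation length $\mathfrak{T}>0$ define $K^{\mathfrak{T}}$ by $$(K^{\mathfrak{T}})_{ij}=\begin{cases}K_{ij} & \text{if }|i-j|\le\mathfrak{T},\\ 0 & \text{if }|i-j|>\mathfrak{T}.\end{cases}$$ Then $$\|K-K^{\mathfrak{T}}\|_{\mathcal{B}(\ell^2(\mathbb{Z}))}\le C_0\,w(\mathfrak{T})^{-1},$$ where $C_0=\|K\|_{\mathcal{S}_{q,w}(\mathbb{Z})}$ and $w(\mathfrak{T})=\inf_{|i-j|>\mathfrak{T}}w(i,j)$.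
   Context: $\mathcal{B}(\ell^2(\mathbb{Z}))$ is the algebra of bounded operators on $\ell^2(\mathbb{Z})$. A coupling weight function on $\mathbb{Z}\times\mathbb{Z}$ is a positive function $w$ with $w(i,j)\ge 1$, $w(i,j)=w(j,i)$ for all $i,j$, and $\sup_i w(i,i)<\infty$. For $0<q\le 1$ and the quasi-distance $\rho(i,j)=|i-j|$, $w$ is admissible if there exist a companion weight function $u$ (itself a coupling weight function), $\theta\in(0,1)$ and $D>0$ such that $w(i,j)\le w(i,k)u(k,j)+u(i,k)w(k,j)$ for all $i,j,k$, and for all $t\ge 1$ $$\sup_{i}\inf_{\tau\ge 0}\left\{\Big[\sum_{j:\,\rho(i,j)<\tau}|u(i,j)|^{\frac{2q}{2-q}}\Big]^{1-\frac q2}+t\sup_{j:\,\rho(i,j)\ge\tau}\Big(\frac{u(i,j)}{w(i,j)}\Big)^q\right\}\le D\,t^{1-\theta}.$$ $\mathcal{S}_{q,w}(\mathbb{Z})$ is the set of matrices $A=[a_{ij}]_{i,j\in\mathbb{Z}}$ with $\|A\|_{\mathcal{S}_{q,w}(\mathbb{Z})}<\infty$, where $$\|A\|_{\mathcal{S}_{q,w}(\mathbb{Z})}=\max\Big\{\sup_{i}\Big(\sum_{j}|a_{ij}|^q w(i,j)^q\Big)^{1/q},\ \sup_{j}\Big(\sum_{i}|a_{ij}|^q w(i,j)^q\Big)^{1/q}\Big\}.$$ *)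

theory Defs
  imports "HOL-Analysis.Analysis"
begin

typedef ell2 = "{x :: int \<Rightarrow> complex. (\<lambda>j. (cmod (x j))\<^sup>2) summable_on UNIV}"
  morphisms ell2_nth Abs_ell2
  by (rule exI[of _ "\<lambda>_. 0"]) simp

setup_lifting type_definition_ell2

lemma ell2_sum_finite:
  "finite F \<Longrightarrow> sqrt (\<Sum>j\<in>F. (cmod (ell2_nth x j))\<^sup>2)
     \<le> sqrt (\<Sum>\<^sub>\<infinity>j. (cmod (ell2_nth x j))\<^sup>2)"
  using ell2_nth[of x]
  by (intro real_sqrt_le_mono finite_sum_le_infsum) auto

lemma ell2_add_partial:
  assumes "finite F"
  shows "(\<Sum>j\<in>F. (cmod (ell2_nth x j + ell2_nth y j))\<^sup>2)
    \<le> (sqrt (\<Sum>\<^sub>\<infinity>j. (cmod (ell2_nth x j))\<^sup>2) + sqrt (\<Sum>\<^sub>\<infinity>j. (cmod (ell2_nth y j))\<^sup>2))\<^sup>2"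
proof -
  have "L2_set (\<lambda>j. cmod (ell2_nth x j + ell2_nth y j)) F
      \<le> L2_set (\<lambda>j. cmod (ell2_nth x j) + cmod (ell2_nth y j)) F"
    by (intro L2_set_mono) (auto intro: norm_triangle_ineq)
  also have "\<dots> \<le> L2_set (\<lambda>j. cmod (ell2_nth x j)) F + L2_set (\<lambda>j. cmod (ell2_nth y j)) F"
    by (rule L2_set_triangle_ineq)
  also have "\<dots> \<le> sqrt (\<Sum>\<^sub>\<infinity>j. (cmod (ell2_nth x j))\<^sup>2) + sqrt (\<Sum>\<^sub>\<infinity>j. (cmod (ell2_nth y j))\<^sup>2)"
    unfolding L2_set_def using ell2_sum_finite[OF assms] by (intro add_mono)
  finally show ?thesis
    unfolding L2_set_def by (rule sqrt_le_D)
qed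

instantiation ell2 :: real_vector
begin

lift_definition zero_ell2 :: ell2 is "\<lambda>_. 0" by simp

lift_definition plus_ell2 :: "ell2 \<Rightarrow> ell2 \<Rightarrow> ell2" is "\<lambda>x y j. x j + y j"
proof -
  fix x y :: "int \<Rightarrow> complex"
  assume "(\<lambda>j. (cmod (x j))\<^sup>2) summable_on UNIV" "(\<lambda>j. (cmod (y j))\<^sup>2) summable_on UNIV"
  then have xy: "ell2_nth (Abs_ell2 x) = x" "ell2_nth (Abs_ell2 y) = y"
    by (auto intro!: Abs_ell2_inverse)
  show "(\<lambda>j. (cmod (x j + y j))\<^sup>2) summable_on UNIV"
    using ell2_add_partial[of _ "Abs_ell2 x" "Abs_ell2 y"] unfolding xy
    by (intro nonneg_bdd_above_summable_on) (auto simp: bdd_above_def)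
qed

lift_definition uminus_ell2 :: "ell2 \<Rightarrow> ell2" is "\<lambda>x j. - x j" by simp

definition minus_ell2 :: "ell2 \<Rightarrow> ell2 \<Rightarrow> ell2" where
  "minus_ell2 x y = x + - y"

lift_definition scaleR_ell2 :: "real \<Rightarrow> ell2 \<Rightarrow> ell2" is "\<lambda>c x j. c *\<^sub>R x j"
  by (simp add: power_mult_distrib summable_on_cmult_right)

instance
  by standard
    (auto simp: minus_ell2_def scaleR_add_right scaleR_add_left
      plus_ell2.rep_eq zero_ell2.rep_eq uminus_ell2.rep_eq scaleR_ell2.rep_eq
      simp flip: ell2_nth_inject)

end

instantiation ell2 :: real_normed_vector
begin

definition norm_ell2 :: "ell2 \<Rightarrow> real" where
  "norm_ell2 x = sqrt (\<Sum>\<^sub>\<infinity>j. (cmod (ell2_nth x j))\<^sup>2)"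

definition sgn_ell2 :: "ell2 \<Rightarrow> ell2" where
  "sgn_ell2 x = inverse (norm x) *\<^sub>R x"

definition dist_ell2 :: "ell2 \<Rightarrow> ell2 \<Rightarrow> real" where
  "dist_ell2 x y = norm (x - y)"

definition uniformity_ell2 :: "(ell2 \<times> ell2) filter" where
  "uniformity_ell2 = (INF e\<in>{0<..}. principal {(x, y). dist x y < e})"

definition open_ell2 :: "ell2 set \<Rightarrow> bool" where
  "open_ell2 U = (\<forall>x\<in>U. eventually (\<lambda>(x', y). x' = x \<longrightarrow> y \<in> U) uniformity)"

instance
proof
  fix x y :: ell2 and a :: real
  show "norm x = 0 \<longleftrightarrow> x = 0"
  proof
    assume "norm x = 0"
    then have "(\<Sum>\<^sub>\<infinity>j. (cmod (ell2_nth x j))\<^sup>2) = 0"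
      by (simp add: norm_ell2_def)
    then have "(cmod (ell2_nth x j))\<^sup>2 = 0" for j
      using ell2_nth[of x] by (intro nonneg_infsum_le_0D[of _ UNIV]) auto
    then show "x = 0"
      by (auto simp: zero_ell2.rep_eq simp flip: ell2_nth_inject)
  qed (simp add: norm_ell2_def zero_ell2.rep_eq)
  show "norm (x + y) \<le> norm x + norm y"
    unfolding norm_ell2_def
  proof (rule real_le_lsqrt)
    show "(\<Sum>\<^sub>\<infinity>j. (cmod (ell2_nth (x + y) j))\<^sup>2)
      \<le> (sqrt (\<Sum>\<^sub>\<infinity>j. (cmod (ell2_nth x j))\<^sup>2) + sqrt (\<Sum>\<^sub>\<infinity>j. (cmod (ell2_nth y j))\<^sup>2))\<^sup>2"
      using ell2_nth[of "x + y"] ell2_add_partial[of _ x y]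
      by (intro infsum_le_finite_sums) (auto simp: plus_ell2.rep_eq)
  qed (auto intro!: add_nonneg_nonneg infsum_nonneg)
  show "norm (a *\<^sub>R x) = \<bar>a\<bar> * norm x"
    by (simp add: norm_ell2_def scaleR_ell2.rep_eq power_mult_distrib infsum_cmult_right'
        real_sqrt_mult)
qed (simp_all add: sgn_ell2_def dist_ell2_def uniformity_ell2_def open_ell2_def)

end

text \<open>
  \<open>T\<close> is the bounded operator on \<open>ell2\<close> whose matrix is \<open>A\<close>. The type of \<open>T\<close> only provides
  real linearity, but the defining equation makes \<open>T\<close> complex-linear, and \<open>norm T\<close> is the
  usual operator norm. By the lemma below \<open>T\<close> is determined by \<open>A\<close>.
\<close>

definition has_matrix :: "(ell2 \<Rightarrow>\<^sub>L ell2) \<Rightarrow> (int \<Rightarrow> int \<Rightarrow> complex) \<Rightarrow> bool" where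
  "has_matrix T A \<longleftrightarrow>
     (\<forall>x i. ((\<lambda>j. A i j * ell2_nth x j) has_sum ell2_nth (blinfun_apply T x) i) UNIV)"

lemma has_matrix_unique:
  assumes "has_matrix S A" "has_matrix T A"
  shows "S = T"
proof (rule blinfun_eqI)
  fix x
  have "ell2_nth (blinfun_apply S x) i = ell2_nth (blinfun_apply T x) i" for i
    using assms unfolding has_matrix_def by (metis has_sum_unique)
  then show "blinfun_apply S x = blinfun_apply T x"
    by (auto simp flip: ell2_nth_inject)
qed


definition coupling_weight :: "(int \<Rightarrow> int \<Rightarrow> real) \<Rightarrow> bool" where
  "coupling_weight w \<longleftrightarrow>
     (\<forall>i j. w i j \<ge> 1) \<and> (\<forall>i j. w i j = w j i) \<and> bdd_above (range (\<lambda>i. w i i))"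

definition rho :: "int \<Rightarrow> int \<Rightarrow> real" where
  "rho i j = real_of_int \<bar>i - j\<bar>"

text \<open>Real powers on the extended half line, with \<open>\<infinity>\<^sup>p = \<infinity>\<close>; only used for \<open>p > 0\<close>.\<close>

definition ennpowr :: "ennreal \<Rightarrow> real \<Rightarrow> ennreal" where
  "ennpowr x p = (if x = \<infinity> then \<infinity> else ennreal (enn2real x powr p))"

text \<open>Suprema, infima and sums are taken in \<open>ennreal\<close>, so that they may be infinite.\<close>

definition admissible :: "real \<Rightarrow> (int \<Rightarrow> int \<Rightarrow> real) \<Rightarrow> bool" where
  "admissible q w \<longleftrightarrow>
     (\<exists>u \<theta> D. coupling_weight u \<and> 0 < \<theta> \<and> \<theta> < 1 \<and> 0 < D \<and>
        (\<forall>i j k. w i j \<le> w i k * u k j + u i k * w k j) \<and>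
        (\<forall>t\<ge>1.
           (SUP i. INF \<tau>\<in>{0..}.
              ennpowr (\<Sum>\<^sub>\<infinity>j\<in>{j. rho i j < \<tau>}. ennreal (\<bar>u i j\<bar> powr (2 * q / (2 - q)))) (1 - q / 2)
              + ennreal t * (SUP j\<in>{j. rho i j \<ge> \<tau>}. ennreal ((u i j / w i j) powr q)))
           \<le> ennreal (D * t powr (1 - \<theta>))))"

definition S_norm :: "real \<Rightarrow> (int \<Rightarrow> int \<Rightarrow> real) \<Rightarrow> (int \<Rightarrow> int \<Rightarrow> complex) \<Rightarrow> ennreal" where
  "S_norm q w A = max
     (SUP i. ennpowr (\<Sum>\<^sub>\<infinity>j. ennreal (cmod (A i j) powr q * w i j powr q)) (1 / q))
     (SUP j. ennpowr (\<Sum>\<^sub>\<infinity>i. ennreal (cmod (A i j) powr q * w i j powr q)) (1 / q))"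

definition S_class :: "real \<Rightarrow> (int \<Rightarrow> int \<Rightarrow> real) \<Rightarrow> (int \<Rightarrow> int \<Rightarrow> complex) set" where
  "S_class q w = {A. S_norm q w A < \<infinity>}"

definition truncate :: "real \<Rightarrow> (int \<Rightarrow> int \<Rightarrow> complex) \<Rightarrow> int \<Rightarrow> int \<Rightarrow> complex" where
  "truncate L K i j = (if real_of_int \<bar>i - j\<bar> \<le> L then K i j else 0)"

definition tail_weight :: "(int \<Rightarrow> int \<Rightarrow> real) \<Rightarrow> real \<Rightarrow> real" where
  "tail_weight w L = (INF (i, j)\<in>{(i, j). real_of_int \<bar>i - j\<bar> > L}. w i j)"

end

theory Submission
  imports Defs
begin

text \<open>
  Off the band \<open>\<bar>i - j\<bar> \<le> L\<close> the weight is at least \<open>tail_weight w L\<close>, and since \<open>q \<le> 1\<close> the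
  \<open>\<ell>\<^sup>q\<close> quasi-norm dominates the \<open>\<ell>\<^sup>1\<close> norm. Hence the rows and columns of the tail matrix have
  \<open>\<ell>\<^sup>1\<close> norm at most \<open>C\<^sub>0 / w(L)\<close>, and Schur's test bounds the operator norm by the same number.
\<close>

section \<open>From the weighted quasi-norm to weighted absolute sums\<close>

lemma sum_le_of_sum_powr_le:
  fixes x :: "'a \<Rightarrow> real"
  assumes "finite F" "0 < q" "q \<le> 1" "0 \<le> C" "\<And>j. j \<in> F \<Longrightarrow> 0 \<le> x j"
    and le: "(\<Sum>j\<in>F. x j powr q) \<le> C powr q"
  shows "(\<Sum>j\<in>F. x j) \<le> C"
proof -
  \<comment> \<open>Each single term is dominated by the sum of \<open>q\<close>-th powers. This
    lets the factor \<open>x j powr (1 - q)\<close> be replaced by \<open>C powr (1 - q)\<close>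
    below, as \<open>1 - q\<close> is nonnegative.\<close>
  have xC: "x j \<le> C" if "j \<in> F" for j
  proof -
    have "x j powr q \<le> (\<Sum>j\<in>F. x j powr q)"
      using assms(1) that by (intro member_le_sum) auto
    with le have "x j powr q \<le> C powr q" by linarith
    then show ?thesis
      using assms that by (metis not_le powr_less_mono2)
  qed
  have "(\<Sum>j\<in>F. x j) \<le> (\<Sum>j\<in>F. x j powr q * C powr (1 - q))"
  proof (rule sum_mono)
    fix j assume j: "j \<in> F"
    \<comment> \<open>This also holds at \<open>x j = 0\<close>, because \<open>0 powr p = 0\<close>
      for every \<open>p\<close>.\<close>
    have "x j = x j powr q * x j powr (1 - q)"
      using assms(5)[OF j] by (simp flip: powr_add)
    also have "\<dots> \<le> x j powr q * C powr (1 - q)"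
      using assms(3) assms(5)[OF j] xC[OF j] by (intro mult_left_mono powr_mono2) auto
    finally show "x j \<le> x j powr q * C powr (1 - q)" .
  qed
  also have "\<dots> = (\<Sum>j\<in>F. x j powr q) * C powr (1 - q)"
    by (simp add: sum_distrib_right)
  also have "\<dots> \<le> C powr q * C powr (1 - q)"
    using le by (intro mult_right_mono) auto
  also have "\<dots> = C"
    using assms(4) by (simp flip: powr_add)
  finally show ?thesis .
qed

lemma ennpowr_inverse_le_imp_le:
  assumes "ennpowr X (1 / q) \<le> ennreal C" "0 < q" "0 \<le> C"
  shows "X \<le> ennreal (C powr q)"
proof (cases X)
  case (real r)
  then have "r powr (1 / q) \<le> C"
    using assms by (simp add: ennpowr_def)
  then have "(r powr (1 / q)) powr q \<le> C powr q"
    using assms by (intro powr_mono2) auto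
  with real assms show ?thesis
    by (simp add: powr_powr ennreal_leI)
qed (use assms in \<open>simp add: ennpowr_def top_unique\<close>)

text \<open>Leads from the extended half line back to the reals: an infinite sum in
  \<open>ennreal\<close> is the supremum of its finite partial sums, so a finite bound passes to
  each of them.\<close>

lemma sum_le_of_ennpowr_infsum_le:
  assumes "ennpowr (\<Sum>\<^sub>\<infinity>j. ennreal (f j)) (1 / q) \<le> ennreal C"
    and "0 < q" "0 \<le> C" "finite F" "\<And>j. 0 \<le> f j"
  shows "(\<Sum>j\<in>F. f j) \<le> C powr q"
proof -
  have "ennreal (\<Sum>j\<in>F. f j) = (\<Sum>j\<in>F. ennreal (f j))"
    using assms(5) by simp
  also have "\<dots> \<le> (\<Sum>\<^sub>\<infinity>j. ennreal (f j))"
    using assms(4) by (simp add: nonneg_infsum_complete SUP_upper)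
  also have "\<dots> \<le> ennreal (C powr q)"
    using assms(1-3) by (rule ennpowr_inverse_le_imp_le)
  finally show ?thesis
    by (simp add: ennreal_le_iff)
qed

lemma S_class_sum_le:
  assumes "0 < q" "q \<le> 1" "\<And>i j. 0 \<le> w i j" "K \<in> S_class q w" "finite F"
  defines "C \<equiv> enn2real (S_norm q w K)"
  shows "(\<Sum>j\<in>F. cmod (K i j) * w i j) \<le> C" (is ?rows)
    and "(\<Sum>i\<in>F. cmod (K i j) * w i j) \<le> C" (is ?cols)
proof -
  \<comment> \<open>Membership in the class excludes the value infinity, so \<open>enn2real\<close>
    loses nothing.\<close>
  have C: "S_norm q w K = ennreal C"
    using assms(4) by (simp add: C_def S_class_def)
  have C0: "0 \<le> C"
    by (simp add: C_def)
  have "ennpowr (\<Sum>\<^sub>\<infinity>j. ennreal (cmod (K i j) powr q * w i j powr q)) (1 / q) \<le> ennreal C"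
    unfolding C[symmetric] S_norm_def by (intro max.coboundedI1 SUP_upper) simp
  from sum_le_of_ennpowr_infsum_le[OF this assms(1) C0 assms(5)]
  show ?rows
    by - (rule sum_le_of_sum_powr_le[OF assms(5,1,2) C0], auto simp: powr_mult assms(3))
  have "ennpowr (\<Sum>\<^sub>\<infinity>i. ennreal (cmod (K i j) powr q * w i j powr q)) (1 / q) \<le> ennreal C"
    unfolding C[symmetric] S_norm_def by (intro max.coboundedI2 SUP_upper) simp
  from sum_le_of_ennpowr_infsum_le[OF this assms(1) C0 assms(5)]
  show ?cols
    by - (rule sum_le_of_sum_powr_le[OF assms(5,1,2) C0], auto simp: powr_mult assms(3))
qed

section \<open>Schur's test on \<open>ell2\<close>\<close>

lemma weighted_Cauchy_Schwarz:
  fixes a x :: "'a \<Rightarrow> real"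
  assumes "\<And>j. j \<in> F \<Longrightarrow> 0 \<le> a j"
  shows "(\<Sum>j\<in>F. a j * x j)\<^sup>2 \<le> (\<Sum>j\<in>F. a j) * (\<Sum>j\<in>F. a j * (x j)\<^sup>2)"
proof -
  have "(\<Sum>j\<in>F. a j * x j) = (\<Sum>j\<in>F. sqrt (a j) * (sqrt (a j) * x j))"
    using assms by (intro sum.cong) (auto simp flip: mult.assoc)
  also have "\<dots>\<^sup>2 \<le> (\<Sum>j\<in>F. (sqrt (a j))\<^sup>2) * (\<Sum>j\<in>F. (sqrt (a j) * x j)\<^sup>2)"
    by (rule Cauchy_Schwarz_ineq_sum)
  also have "\<dots> = (\<Sum>j\<in>F. a j) * (\<Sum>j\<in>F. a j * (x j)\<^sup>2)"
    using assms by (simp add: power_mult_distrib)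
  finally show ?thesis .
qed

lemma norm_ell2_power2: "(norm x)\<^sup>2 = (\<Sum>\<^sub>\<infinity>j. (cmod (ell2_nth x j))\<^sup>2)"
  by (simp add: norm_ell2_def infsum_nonneg)

lemma sum_cmod_power2_le_norm:
  "finite F \<Longrightarrow> (\<Sum>j\<in>F. (cmod (ell2_nth x j))\<^sup>2) \<le> (norm x)\<^sup>2"
  unfolding norm_ell2_power2 using ell2_nth[of x] by (intro finite_sum_le_infsum) auto

text \<open>Both bounds concern finite sums only; every summability claim is derived from
  them.\<close>

context
  fixes A :: "int \<Rightarrow> int \<Rightarrow> complex" and M :: real
  assumes rows: "\<And>i F. finite F \<Longrightarrow> (\<Sum>j\<in>F. cmod (A i j)) \<le> M"
    and cols: "\<And>j F. finite F \<Longrightarrow> (\<Sum>i\<in>F. cmod (A i j)) \<le> M"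
begin

lemma Schur_bound_nonneg: "0 \<le> M"
  using rows[of "{}"] by simp

text \<open>Cauchy-Schwarz with the entries \<open>cmod (A i j)\<close> as weights; their row sum
  supplies the factor \<open>M\<close>.\<close>

lemma Schur_partial_sum:
  assumes "finite F"
  shows "(\<Sum>j\<in>F. cmod (A i j * ell2_nth x j))\<^sup>2
    \<le> M * (\<Sum>j\<in>F. cmod (A i j) * (cmod (ell2_nth x j))\<^sup>2)"
proof -
  have "(\<Sum>j\<in>F. cmod (A i j) * cmod (ell2_nth x j))\<^sup>2
      \<le> (\<Sum>j\<in>F. cmod (A i j)) * (\<Sum>j\<in>F. cmod (A i j) * (cmod (ell2_nth x j))\<^sup>2)"
    by (rule weighted_Cauchy_Schwarz) simp
  also have "\<dots> \<le> M * (\<Sum>j\<in>F. cmod (A i j) * (cmod (ell2_nth x j))\<^sup>2)"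
    using rows[OF assms] by (intro mult_right_mono sum_nonneg) auto
  finally show ?thesis by (simp add: norm_mult)
qed

text \<open>Exchanging the two finite sums turns the remaining weights into column sums, which
  supply the second factor \<open>M\<close>. The bound depends on neither \<open>F\<close> nor
  \<open>G\<close>.\<close>

lemma Schur_double_sum:
  assumes "finite F" "finite G"
  shows "(\<Sum>i\<in>G. (\<Sum>j\<in>F. cmod (A i j * ell2_nth x j))\<^sup>2) \<le> (M * norm x)\<^sup>2"
proof -
  have "(\<Sum>i\<in>G. (\<Sum>j\<in>F. cmod (A i j * ell2_nth x j))\<^sup>2)
      \<le> (\<Sum>i\<in>G. M * (\<Sum>j\<in>F. cmod (A i j) * (cmod (ell2_nth x j))\<^sup>2))"
    by (intro sum_mono Schur_partial_sum assms)
  also have "\<dots> = M * (\<Sum>i\<in>G. \<Sum>j\<in>F. cmod (A i j) * (cmod (ell2_nth x j))\<^sup>2)"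
    by (simp add: sum_distrib_left)
  also have "\<dots> = M * (\<Sum>j\<in>F. (\<Sum>i\<in>G. cmod (A i j)) * (cmod (ell2_nth x j))\<^sup>2)"
    by (subst sum.swap) (simp add: sum_distrib_right)
  also have "\<dots> \<le> M * (\<Sum>j\<in>F. M * (cmod (ell2_nth x j))\<^sup>2)"
    using cols[OF assms(2)] Schur_bound_nonneg
    by (intro mult_left_mono sum_mono mult_right_mono) auto
  also have "\<dots> = M\<^sup>2 * (\<Sum>j\<in>F. (cmod (ell2_nth x j))\<^sup>2)"
    by (simp add: power2_eq_square sum_distrib_left mult.assoc)
  also have "\<dots> \<le> M\<^sup>2 * (norm x)\<^sup>2"
    by (intro mult_left_mono sum_cmod_power2_le_norm assms) auto
  finally show ?thesis by (simp add: power_mult_distrib)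
qed

lemma Schur_abs_summable: "(\<lambda>j. cmod (A i j * ell2_nth x j)) summable_on UNIV"
proof (rule nonneg_bdd_above_summable_on)
  have "(\<Sum>j\<in>F. cmod (A i j * ell2_nth x j)) \<le> M * norm x" if "finite F" for F
    using Schur_double_sum[OF that, of "{i}"] Schur_bound_nonneg
    by (auto intro: power2_le_imp_le)
  then show "bdd_above (sum (\<lambda>j. cmod (A i j * ell2_nth x j)) ` {F. F \<subseteq> UNIV \<and> finite F})"
    by (auto simp: bdd_above_def)
qed simp

text \<open>For fixed finite \<open>G\<close>, the left side of \<open>Schur_double_sum\<close>
  converges as \<open>F\<close> exhausts the integers, and its uniform bound survives in the
  limit.\<close>

lemma Schur_image_sum:
  assumes "finite G"
  shows "(\<Sum>i\<in>G. (cmod (\<Sum>\<^sub>\<infinity>j. A i j * ell2_nth x j))\<^sup>2) \<le> (M * norm x)\<^sup>2"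
proof -
  let ?f = "\<lambda>i j. cmod (A i j * ell2_nth x j)"
  have "((\<lambda>F. \<Sum>i\<in>G. (\<Sum>j\<in>F. ?f i j)\<^sup>2) \<longlongrightarrow> (\<Sum>i\<in>G. (\<Sum>\<^sub>\<infinity>j. ?f i j)\<^sup>2)) (finite_subsets_at_top UNIV)"
    using Schur_abs_summable by (intro tendsto_intros infsum_tendsto)
  then have "(\<Sum>i\<in>G. (\<Sum>\<^sub>\<infinity>j. ?f i j)\<^sup>2) \<le> (M * norm x)\<^sup>2"
    by (rule tendsto_upperbound)
      (auto intro!: eventually_finite_subsets_at_top_weakI Schur_double_sum assms)
  moreover have "(\<Sum>i\<in>G. (cmod (\<Sum>\<^sub>\<infinity>j. A i j * ell2_nth x j))\<^sup>2) \<le> (\<Sum>i\<in>G. (\<Sum>\<^sub>\<infinity>j. ?f i j)\<^sup>2)"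
    by (intro sum_mono power_mono norm_infsum_bound Schur_abs_summable) auto
  ultimately show ?thesis by linarith
qed

theorem Schur_test: "\<exists>T. has_matrix T A \<and> norm T \<le> M"
proof -
  define y where "y x i = (\<Sum>\<^sub>\<infinity>j. A i j * ell2_nth x j)" for x i
  define T where "T x = Abs_ell2 (y x)" for x
  \<comment> \<open>Only once \<open>y x\<close> is known to be square summable does
    \<open>Abs_ell2\<close> return a vector with these coordinates.\<close>
  have y_summable: "(\<lambda>i. (cmod (y x i))\<^sup>2) summable_on UNIV" for x
    using Schur_image_sum[of _ x]
    by (intro nonneg_bdd_above_summable_on) (auto simp: bdd_above_def y_def)
  then have nth_T: "ell2_nth (T x) = y x" for x
    by (simp add: T_def Abs_ell2_inverse)
  have has_sum: "((\<lambda>j. A i j * ell2_nth x j) has_sum y x i) UNIV" for x i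
    unfolding y_def by (rule has_sum_infsum[OF abs_summable_summable[OF Schur_abs_summable]])
  have norm_T: "norm (T x) \<le> M * norm x" for x
  proof (rule power2_le_imp_le)
    show "(norm (T x))\<^sup>2 \<le> (M * norm x)\<^sup>2"
      unfolding norm_ell2_power2 nth_T using Schur_image_sum[of _ x]
      by (intro infsum_le_finite_sums y_summable) (auto simp: y_def)
  qed (use Schur_bound_nonneg in auto)
  have y_add: "y (x + z) i = y x i + y z i" for x z i
    using has_sum_add[OF has_sum[of i x] has_sum[of i z]] has_sum[of i "x + z"]
    by (simp add: plus_ell2.rep_eq distrib_left has_sum_unique)
  have y_scaleR: "y (c *\<^sub>R x) i = c *\<^sub>R y x i" for c x i
    \<comment> \<open>The real scalar is treated as a complex factor that commutes past
      \<open>A i j\<close>.\<close>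
    using has_sum_cmult_right[OF has_sum[of i x], of "of_real c"] has_sum[of i "c *\<^sub>R x"]
    by (simp add: scaleR_ell2.rep_eq scaleR_conv_of_real mult.left_commute has_sum_unique)
  have bl: "bounded_linear T"
  proof (rule bounded_linear_intro)
    show "T (x + z) = T x + T z" for x z
      by (simp add: nth_T plus_ell2.rep_eq y_add fun_eq_iff flip: ell2_nth_inject)
    show "T (c *\<^sub>R x) = c *\<^sub>R T x" for c x
      by (simp add: nth_T scaleR_ell2.rep_eq y_scaleR fun_eq_iff flip: ell2_nth_inject)
    show "norm (T x) \<le> norm x * M" for x
      using norm_T[of x] by (simp add: mult.commute)
  qed
  show ?thesis
  proof (intro exI conjI)
    show "has_matrix (Blinfun T) A"
      using has_sum by (simp add: has_matrix_def bounded_linear_Blinfun_apply[OF bl] nth_T)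
    show "norm (Blinfun T) \<le> M"
      using norm_T Schur_bound_nonneg
      by (intro norm_blinfun_bound) (auto simp: bounded_linear_Blinfun_apply[OF bl])
  qed
qed

end

section \<open>The tail matrix and its weight\<close>

lemma tail_weight_le:
  assumes "\<And>i j. 1 \<le> w i j" "L < real_of_int \<bar>i - j\<bar>"
  shows "tail_weight w L \<le> w i j"
  unfolding tail_weight_def using assms
  by (intro cINF_lower2[where x = "(i, j)"]) (auto intro!: bdd_belowI2[where m = 1])

lemma tail_weight_ge_1:
  assumes "\<And>i j. 1 \<le> w i j"
  shows "1 \<le> tail_weight w L"
proof -
  \<comment> \<open>A lower bound for an infimum of reals requires a nonempty index set; adding 1
    makes the inequality strict.\<close>
  have "(\<lceil>\<bar>L\<bar>\<rceil> + 1, 0) \<in> {(i, j). L < real_of_int \<bar>i - j\<bar>}"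
    by simp linarith
  then show ?thesis
    unfolding tail_weight_def using assms by (intro cINF_greatest) (blast, auto)
qed

text \<open>Inside the band the left side vanishes; outside it, the ratio of \<open>w i j\<close> to
  \<open>tail_weight w L\<close> is at least 1.\<close>

lemma cmod_tail_le:
  fixes w :: "int \<Rightarrow> int \<Rightarrow> real"
  assumes "\<And>i j. 1 \<le> w i j"
  shows "cmod (K i j - truncate L K i j) \<le> cmod (K i j) * w i j * inverse (tail_weight w L)"
proof (cases "real_of_int \<bar>i - j\<bar> \<le> L")
  case True
  have "0 \<le> w i j" "0 \<le> tail_weight w L"
    using assms[of i j] tail_weight_ge_1[where w = w and L = L, OF assms] by linarith+
  with True show ?thesis by (simp add: truncate_def)
next
  case False
  then have "tail_weight w L \<le> w i j"
    using assms by (intro tail_weight_le) auto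
  then have "1 \<le> w i j * inverse (tail_weight w L)"
    using tail_weight_ge_1[where w = w and L = L, OF assms] by (simp add: field_simps)
  then have "cmod (K i j) * 1 \<le> cmod (K i j) * (w i j * inverse (tail_weight w L))"
    by (intro mult_left_mono) auto
  with False show ?thesis by (simp add: truncate_def mult.assoc)
qed

theorem theorem10p1:
  fixes q L :: real
    and w :: "int \<Rightarrow> int \<Rightarrow> real"
    and K :: "int \<Rightarrow> int \<Rightarrow> complex"
  assumes "0 < q" and "q \<le> 1"
    and "coupling_weight w"
    and "admissible q w"
    and "K \<in> S_class q w"
    and "0 < L"
  shows "\<exists>T. has_matrix T (\<lambda>i j. K i j - truncate L K i j) \<and>
             norm T \<le> enn2real (S_norm q w K) * inverse (tail_weight w L)"
proof (rule Schur_test)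
  have w1: "1 \<le> w i j" for i j
    using assms(3) by (simp add: coupling_weight_def)
  then have w0: "0 \<le> w i j" for i j
    using order_trans zero_le_one by blast
  have W0: "0 \<le> inverse (tail_weight w L)"
    using tail_weight_ge_1[of w L] w1 by simp
  note le = S_class_sum_le[OF assms(1,2) w0 assms(5)]
  fix F :: "int set" assume F: "finite F"
  show "(\<Sum>j\<in>F. cmod (K i j - truncate L K i j))
      \<le> enn2real (S_norm q w K) * inverse (tail_weight w L)" for i
  proof -
    \<comment> \<open>The entrywise bound trades the cut-off for a weight, leaving a constant times
      a sum controlled by \<open>le\<close>.\<close>
    have "(\<Sum>j\<in>F. cmod (K i j - truncate L K i j))
        \<le> (\<Sum>j\<in>F. cmod (K i j) * w i j * inverse (tail_weight w L))"
      by (intro sum_mono cmod_tail_le w1)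
    also have "\<dots> \<le> enn2real (S_norm q w K) * inverse (tail_weight w L)"
      unfolding sum_distrib_right[symmetric] by (intro mult_right_mono le F W0)
    finally show ?thesis .
  qed
  show "(\<Sum>i\<in>F. cmod (K i j - truncate L K i j))
      \<le> enn2real (S_norm q w K) * inverse (tail_weight w L)" for j
  proof -
    have "(\<Sum>i\<in>F. cmod (K i j - truncate L K i j))
        \<le> (\<Sum>i\<in>F. cmod (K i j) * w i j * inverse (tail_weight w L))"
      by (intro sum_mono cmod_tail_le w1)
    also have "\<dots> \<le> enn2real (S_norm q w K) * inverse (tail_weight w L)"
      unfolding sum_distrib_right[symmetric] by (intro mult_right_mono le F W0)
    finally show ?thesis .
  qed
qed

end
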